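(* Let $\Omega=\{1,\dots,n\}$ and let $\phi:\mathbb{R}\to\mathbb{R}$ be a concave (univariate) polynomial of degree $2d$ with $d\le n-1$. Then the set function $f:2^\Omega\to\mathbb{R}$ defined by $f(S)=\phi(|S|)$ for $S\subseteq\Omega$ is $d$-sos-submodular.
   Context: The multilinear extension (MLE) of a set function $f:2^\Omega\to\mathbb{R}$ is the unique multilinear polynomial $F\in\mathbb{R}[x_1,\dots,x_n]$ (every variable appears with power at most $1$ in every monomial) with $F(1_S)=f(S)$ for all $S\subseteq\Omega$, where $1_S\in\{0,1\}^n$ is the indicator vector of $S$. For an ideal $I$ of a real polynomial ring, a polynomial $p$ is $t$-sos modulo $I$ if there are finitely many polynomials $q_1,\dots,q_m$ in that ring, each of degree at most $t$, with $p-\sum_{r=1}^m q_r^2\in I$. For $i\ne j$, $x_{-i,j}$ denotes the variables $x_1,\dots,x_n$ with $x_i,x_j$ removed, and $I_2[x_{-i,j}]=\langle x_k^2-x_k : k\neq i,j\rangle\subseteq\mathbb{R}[x_{-i,j}]$. The set function $f$ with MLE $F$ is $t$-sos-submodular ($t\in\{0,1,2,\dots\}$) if for all $i\neq j$ the polynomial $-\frac{\partial^2F(x)}{\partial x_i\partial x_j}$ (which does not involve $x_i,x_j$) is $t$-sos modulo $I_2[x_{-i,j}]$. *)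

theory Defs
  imports
    "HOL-Analysis.Convex"
    "HOL-Computational_Algebra.Polynomial"
    "HOL-Algebra.Ideal"
    "HOL-Library.Indicator_Function"
    "HOL-Library.Poly_Mapping"
begin

text \<open>
  Real polynomials in variables indexed by natural numbers: a monomial is a finitely supported
  exponent vector, a polynomial a finitely supported assignment of coefficients to monomials.
  Ring operations are those of the type-class instance for polynomial mappings (convolution product).
\<close>

type_synonym rpoly = "(nat \<Rightarrow>\<^sub>0 nat) \<Rightarrow>\<^sub>0 real"

definition pvar :: "nat \<Rightarrow> rpoly" where
  "pvar i = Poly_Mapping.single (Poly_Mapping.single i 1) 1"

definition pvars :: "rpoly \<Rightarrow> nat set" where
  "pvars p = (\<Union>m\<in>Poly_Mapping.keys p. Poly_Mapping.keys m)"

definition mdegree :: "(nat \<Rightarrow>\<^sub>0 nat) \<Rightarrow> nat" where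
  "mdegree m = (\<Sum>i\<in>Poly_Mapping.keys m. Poly_Mapping.lookup m i)"

text \<open>The zero polynomial gets degree 0.\<close>

definition total_degree :: "rpoly \<Rightarrow> nat" where
  "total_degree p = Max (insert 0 (mdegree ` Poly_Mapping.keys p))"

definition peval :: "rpoly \<Rightarrow> (nat \<Rightarrow> real) \<Rightarrow> real" where
  "peval p x = (\<Sum>m\<in>Poly_Mapping.keys p.
     Poly_Mapping.lookup p m * (\<Prod>i\<in>Poly_Mapping.keys m. x i ^ Poly_Mapping.lookup m i))"

text \<open>
  Exponent subtraction is truncated, but the truncated terms carry the factor
  \<open>lookup m i = 0\<close>.
\<close>

definition pderivative :: "nat \<Rightarrow> rpoly \<Rightarrow> rpoly" where
  "pderivative i p = (\<Sum>m\<in>Poly_Mapping.keys p.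
     Poly_Mapping.single (m - Poly_Mapping.single i 1)
       (Poly_Mapping.lookup p m * real (Poly_Mapping.lookup m i)))"

text \<open>\<open>poly_ring V\<close> is the ring of real polynomials in the variables indexed by \<open>V\<close>.\<close>

definition poly_ring :: "nat set \<Rightarrow> rpoly ring" where
  "poly_ring V = \<lparr>carrier = {p. pvars p \<subseteq> V}, mult = (*), one = 1, zero = 0, add = (+)\<rparr>"

definition boolean_ideal :: "nat set \<Rightarrow> rpoly set" where
  "boolean_ideal V = Idl\<^bsub>poly_ring V\<^esub> ((\<lambda>k. pvar k ^ 2 - pvar k) ` V)"

definition multilinear :: "rpoly \<Rightarrow> bool" where
  "multilinear p \<longleftrightarrow> (\<forall>m\<in>Poly_Mapping.keys p. \<forall>i. Poly_Mapping.lookup m i \<le> 1)"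

text \<open>The ground set is \<open>{1..n}\<close>; only the values of \<open>f\<close> on its subsets matter.\<close>

definition is_mle :: "nat \<Rightarrow> (nat set \<Rightarrow> real) \<Rightarrow> rpoly \<Rightarrow> bool" where
  "is_mle n f F \<longleftrightarrow> F \<in> carrier (poly_ring {1..n}) \<and> multilinear F \<and>
     (\<forall>S\<subseteq>{1..n}. peval F (indicator S) = f S)"

definition mle :: "nat \<Rightarrow> (nat set \<Rightarrow> real) \<Rightarrow> rpoly" where
  "mle n f = (THE F. is_mle n f F)"

definition sos_modulo :: "nat set \<Rightarrow> nat \<Rightarrow> rpoly set \<Rightarrow> rpoly \<Rightarrow> bool" where
  "sos_modulo V t I p \<longleftrightarrow> (\<exists>(m::nat) (q::nat \<Rightarrow> rpoly).
     (\<forall>r<m. q r \<in> carrier (poly_ring V) \<and> total_degree (q r) \<le> t) \<and>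
     p - (\<Sum>r<m. q r ^ 2) \<in> I)"

definition sos_submodular :: "nat \<Rightarrow> nat \<Rightarrow> (nat set \<Rightarrow> real) \<Rightarrow> bool" where
  "sos_submodular n t f \<longleftrightarrow> (\<forall>i\<in>{1..n}. \<forall>j\<in>{1..n}. i \<noteq> j \<longrightarrow>
     sos_modulo ({1..n} - {i, j}) t (boolean_ideal ({1..n} - {i, j}))
       (- pderivative i (pderivative j (mle n f))))"


subsection \<open>The polynomial rings are commutative rings\<close>

lemma pvars_uminus: "pvars (- p) = pvars p"
  by (simp add: pvars_def keys.rep_eq)

lemma pvars_add: "pvars (p + q) \<subseteq> pvars p \<union> pvars q"
  using Poly_Mapping.keys_add[of p q] by (auto simp: pvars_def)

lemma pvars_mult: "pvars (p * q) \<subseteq> pvars p \<union> pvars q"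
proof
  fix i assume "i \<in> pvars (p * q)"
  then obtain m where m: "m \<in> Poly_Mapping.keys (p * q)" "i \<in> Poly_Mapping.keys m"
    by (auto simp: pvars_def)
  then obtain a b where "m = a + b" "a \<in> Poly_Mapping.keys p" "b \<in> Poly_Mapping.keys q"
    using Poly_Mapping.keys_mult[of p q] by auto
  with m(2) Poly_Mapping.keys_add[of a b] show "i \<in> pvars p \<union> pvars q"
    by (auto simp: pvars_def)
qed

lemma poly_ring_cring: "cring (poly_ring V)"
proof (rule cringI)
  show "abelian_group (poly_ring V)"
  proof (rule abelian_groupI)
    fix p assume "p \<in> carrier (poly_ring V)"
    then show "\<exists>y\<in>carrier (poly_ring V). y \<oplus>\<^bsub>poly_ring V\<^esub> p = \<zero>\<^bsub>poly_ring V\<^esub>"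
      by (intro bexI[of _ "- p"]) (auto simp: poly_ring_def pvars_uminus)
  next
    fix p q assume "p \<in> carrier (poly_ring V)" "q \<in> carrier (poly_ring V)"
    then show "p \<oplus>\<^bsub>poly_ring V\<^esub> q \<in> carrier (poly_ring V)"
      using pvars_add[of p q] by (auto simp: poly_ring_def)
  qed (auto simp: poly_ring_def pvars_def algebra_simps)
  show "Group.comm_monoid (poly_ring V)"
  proof (rule comm_monoidI)
    fix p q assume "p \<in> carrier (poly_ring V)" "q \<in> carrier (poly_ring V)"
    then show "p \<otimes>\<^bsub>poly_ring V\<^esub> q \<in> carrier (poly_ring V)"
      using pvars_mult[of p q] by (auto simp: poly_ring_def)
  qed (auto simp: poly_ring_def pvars_def algebra_simps)
qed (auto simp: poly_ring_def algebra_simps)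

lemma boolean_ideal_ideal: "ideal (boolean_ideal V) (poly_ring V)"
proof -
  interpret R: cring "poly_ring V" by (rule poly_ring_cring)
  have *: "pvar k \<in> carrier (poly_ring V)" if "k \<in> V" for k
    using that by (simp add: pvar_def poly_ring_def pvars_def)
  have "pvar k ^ 2 - pvar k \<in> carrier (poly_ring V)" if "k \<in> V" for k
    using *[OF that] pvars_mult[of "pvar k" "pvar k"]
      pvars_add[of "pvar k * pvar k" "- pvar k"]
    by (auto simp: poly_ring_def pvars_uminus power2_eq_square)
  then show ?thesis
    unfolding boolean_ideal_def by (intro R.genideal_ideal) auto
qed


subsection \<open>The multilinear extension exists and is unique\<close>

definition set_monom :: "nat set \<Rightarrow> nat \<Rightarrow>\<^sub>0 nat" where
  "set_monom S = (\<Sum>i\<in>S. Poly_Mapping.single i 1)"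

lemma lookup_set_monom:
  "finite S \<Longrightarrow> Poly_Mapping.lookup (set_monom S) i = of_bool (i \<in> S)"
  by (auto simp: set_monom_def lookup_sum lookup_single when_def)

lemma keys_set_monom: "finite S \<Longrightarrow> Poly_Mapping.keys (set_monom S) = S"
  by (auto simp: keys.rep_eq lookup_set_monom)

lemma set_monom_keys:
  assumes "\<forall>i. Poly_Mapping.lookup m i \<le> 1"
  shows "set_monom (Poly_Mapping.keys m) = m"
proof (rule poly_mapping_eqI)
  fix i
  show "Poly_Mapping.lookup (set_monom (Poly_Mapping.keys m)) i = Poly_Mapping.lookup m i"
    using assms[rule_format, of i] by (auto simp: lookup_set_monom le_Suc_eq in_keys_iff)
qed

lemma peval_indicator:
  assumes "multilinear p" "finite T"
  shows "peval p (indicator T) = (\<Sum>S\<in>Pow T. Poly_Mapping.lookup p (set_monom S))"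
proof -
  have mon: "set_monom (Poly_Mapping.keys m) = m" if "m \<in> Poly_Mapping.keys p" for m
    using assms(1) that by (intro set_monom_keys) (auto simp: multilinear_def)
  have ev: "(\<Prod>i\<in>Poly_Mapping.keys m. (indicator T i :: real) ^ Poly_Mapping.lookup m i)
      = of_bool (Poly_Mapping.keys m \<subseteq> T)" for m
    by (auto simp: indicator_def in_keys_iff zero_power intro!: prod.neutral prod_zero)
  have inj: "inj_on set_monom (Pow T)"
    by (rule inj_on_inverseI[where g = Poly_Mapping.keys])
       (use assms(2) in \<open>auto simp: keys_set_monom dest: finite_subset\<close>)
  have "peval p (indicator T) =
      (\<Sum>m\<in>Poly_Mapping.keys p. Poly_Mapping.lookup p m * of_bool (Poly_Mapping.keys m \<subseteq> T))"
    by (simp add: peval_def ev)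
  also have "\<dots> = (\<Sum>m\<in>Poly_Mapping.keys p \<inter> {m. Poly_Mapping.keys m \<subseteq> T}. Poly_Mapping.lookup p m)"
    by (simp add: sum.inter_restrict)
  also have "\<dots> = (\<Sum>m\<in>set_monom ` Pow T. Poly_Mapping.lookup p m)"
  proof (rule sum.mono_neutral_left)
    show "Poly_Mapping.keys p \<inter> {m. Poly_Mapping.keys m \<subseteq> T} \<subseteq> set_monom ` Pow T"
    proof
      fix m assume m: "m \<in> Poly_Mapping.keys p \<inter> {m. Poly_Mapping.keys m \<subseteq> T}"
      then have "m = set_monom (Poly_Mapping.keys m)" using mon by simp
      with m show "m \<in> set_monom ` Pow T" by blast
    qed
    show "\<forall>m\<in>set_monom ` Pow T - Poly_Mapping.keys p \<inter> {m. Poly_Mapping.keys m \<subseteq> T}.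
        Poly_Mapping.lookup p m = 0"
    proof
      fix m assume m: "m \<in> set_monom ` Pow T - Poly_Mapping.keys p \<inter> {m. Poly_Mapping.keys m \<subseteq> T}"
      then obtain S where "S \<subseteq> T" "m = set_monom S" by blast
      then have "Poly_Mapping.keys m \<subseteq> T"
        using assms(2) keys_set_monom[of S] finite_subset[of S T] by simp
      with m show "Poly_Mapping.lookup p m = 0" by (simp add: in_keys_iff)
    qed
  qed (use assms(2) in auto)
  also have "\<dots> = (\<Sum>S\<in>Pow T. Poly_Mapping.lookup p (set_monom S))"
    using inj by (simp add: sum.reindex)
  finally show ?thesis .
qed

lemma is_mle_unique:
  assumes F: "is_mle n f F" and G: "is_mle n f G"
  shows "F = G"
proof -
  have coeff: "Poly_Mapping.lookup F (set_monom T) = Poly_Mapping.lookup G (set_monom T)"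
    if "T \<subseteq> {1..n}" for T
    using finite_subset[OF that finite_atLeastAtMost] that
  proof (induction T rule: finite_psubset_induct)
    case (psubset T)
    have "peval F (indicator T) = peval G (indicator T)"
      using F G psubset.prems by (simp add: is_mle_def)
    then have "(\<Sum>S\<in>Pow T. Poly_Mapping.lookup F (set_monom S)) =
        (\<Sum>S\<in>Pow T. Poly_Mapping.lookup G (set_monom S))"
      using F G psubset.hyps peval_indicator[of F T] peval_indicator[of G T]
      unfolding is_mle_def by simp
    moreover have "(\<Sum>S\<in>Pow T - {T}. Poly_Mapping.lookup F (set_monom S)) =
        (\<Sum>S\<in>Pow T - {T}. Poly_Mapping.lookup G (set_monom S))"
      using psubset.IH psubset.prems by (intro sum.cong) auto
    ultimately show ?case
      using psubset.hyps
        sum.remove[of "Pow T" T "\<lambda>S. Poly_Mapping.lookup F (set_monom S)"]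
        sum.remove[of "Pow T" T "\<lambda>S. Poly_Mapping.lookup G (set_monom S)"]
      by simp
  qed
  show ?thesis
  proof (rule poly_mapping_eqI)
    fix m
    show "Poly_Mapping.lookup F m = Poly_Mapping.lookup G m"
    proof (cases "m \<in> Poly_Mapping.keys F \<union> Poly_Mapping.keys G")
      case True
      then have "\<forall>i. Poly_Mapping.lookup m i \<le> 1" "Poly_Mapping.keys m \<subseteq> {1..n}"
        using F G by (auto simp: is_mle_def multilinear_def poly_ring_def pvars_def)
      then show ?thesis
        using coeff[of "Poly_Mapping.keys m"] by (simp add: set_monom_keys)
    qed (auto simp: in_keys_iff)
  qed
qed

lemma is_mle_exists: "\<exists>F. is_mle n f F"
proof -
  define c where "c S = (-1) ^ card S * (\<Sum>T\<in>Pow S. (-1) ^ card T * f T)" for S :: "nat set"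
  have c: "f S = sum c (Pow S)" if "finite S" for S
    unfolding c_def
    by (rule inclusion_exclusion_symmetric[where g = "\<lambda>S. \<Sum>T\<in>Pow S. (-1) ^ card T * f T"])
       (simp_all add: that)
  define F :: rpoly where "F = (\<Sum>S\<in>Pow {1..n}. Poly_Mapping.single (set_monom S) (c S))"
  have eq: "set_monom S = set_monom T \<longleftrightarrow> S = T" if "S \<subseteq> {1..n}" "T \<subseteq> {1..n}" for S T
  proof -
    have "finite S" "finite T" using that[THEN finite_subset] by simp_all
    then show ?thesis using keys_set_monom by metis
  qed
  have look: "Poly_Mapping.lookup F (set_monom T) = c T" if T: "T \<subseteq> {1..n}" for T
  proof -
    have "Poly_Mapping.lookup F (set_monom T) = (\<Sum>S\<in>Pow {1..n}. if S = T then c S else 0)"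
      unfolding F_def lookup_sum lookup_single
      by (rule sum.cong) (use eq T in \<open>auto simp: when_def\<close>)
    then show ?thesis using T by simp
  qed
  have keys: "Poly_Mapping.keys F \<subseteq> set_monom ` Pow {1..n}"
  proof
    fix m assume "m \<in> Poly_Mapping.keys F"
    then have "(\<Sum>S\<in>Pow {1..n}. c S when set_monom S = m) \<noteq> 0"
      by (simp add: F_def in_keys_iff lookup_sum lookup_single)
    then obtain S where "S \<in> Pow {1..n}" "(c S when set_monom S = m) \<noteq> 0"
      by (rule sum.not_neutral_contains_not_neutral)
    then show "m \<in> set_monom ` Pow {1..n}"
      by (auto simp: when_def split: if_splits)
  qed
  have ml: "multilinear F"
    unfolding multilinear_def
  proof
    fix m assume "m \<in> Poly_Mapping.keys F"
    then obtain S where "S \<subseteq> {1..n}" "m = set_monom S" using keys by auto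
    then show "\<forall>i. Poly_Mapping.lookup m i \<le> 1"
      using finite_subset[of S "{1..n}"] by (simp add: lookup_set_monom)
  qed
  have "pvars F \<subseteq> {1..n}"
    unfolding pvars_def
  proof (rule UN_least)
    fix m assume "m \<in> Poly_Mapping.keys F"
    then obtain S where "S \<subseteq> {1..n}" "m = set_monom S" using keys by auto
    then show "Poly_Mapping.keys m \<subseteq> {1..n}"
      using keys_set_monom[of S] finite_subset[of S "{1..n}"] by simp
  qed
  moreover have "peval F (indicator T) = f T" if "T \<subseteq> {1..n}" for T
  proof -
    have fin: "finite T" using that by (rule finite_subset) simp
    have "(\<Sum>S\<in>Pow T. Poly_Mapping.lookup F (set_monom S)) = sum c (Pow T)"
      using that by (intro sum.cong refl look) auto
    then show ?thesis using peval_indicator[OF ml fin] c[OF fin] by simp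
  qed
  ultimately have "is_mle n f F" using ml by (simp add: is_mle_def poly_ring_def)
  then show ?thesis ..
qed

lemma is_mle_mle: "is_mle n f (mle n f)"
  unfolding mle_def using is_mle_exists is_mle_unique by (metis theI)

end

theory Submission
  imports Defs "HOL-Computational_Algebra.Fundamental_Theorem_Algebra"
begin

text \<open>
  At the vertex \<open>1\<^sub>S\<close> of the cube, where \<open>S\<close> avoids \<open>i\<close> and \<open>j\<close>, the mixed derivative of the multilinear
  extension is the second difference \<open>f (S \<union> {i, j}) - f (S \<union> {i}) - f (S \<union> {j}) + f S\<close>
  (\<open>peval_mixed_pderivative_indicator\<close>). For \<open>f S = \<phi> |S|\<close> its negative is \<open>g |S|\<close> with
  \<open>g x = 2 \<phi> (x + 1) - \<phi> x - \<phi> (x + 2)\<close>, a univariate polynomial of degree at most that of \<open>\<phi>\<close>.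
  Concavity of \<open>\<phi>\<close> on the whole line, and not merely at the integers, makes \<open>g\<close> nonnegative on the
  whole line. Hence \<open>g\<close> is a sum of squares of univariate polynomials \<open>q\<^sub>r\<close> of at most half the degree
  (\<open>nonneg_poly_sum_of_squares\<close>).

  The squares are carried to several variables by substituting \<open>\<Sum>k. x\<^sub>k\<close>, which has degree one and
  takes the value \<open>|S|\<close> at \<open>1\<^sub>S\<close>. The negated mixed derivative and the sum of the squares of the
  lifted \<open>q\<^sub>r\<close> then agree at every vertex of the cube, so their difference lies in the Boolean ideal
  (\<open>vanishing_on_cube_in_boolean_ideal\<close>).
\<close>

section \<open>Nonnegative univariate polynomials are sums of squares\<close>

text \<open>
  Outside a large enough interval a nonconstant nonnegative polynomial is at least its value at \<open>0\<close>,
  so a minimum over that interval, which contains \<open>0\<close>, is a global one.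
\<close>

lemma nonneg_poly_attains_min:
  fixes p :: "real poly"
  assumes nonneg: "\<And>x. poly p x \<ge> 0"
  shows "\<exists>a. \<forall>x. poly p a \<le> poly p x"
proof (cases "degree p = 0")
  case True
  then obtain c where "p = [:c:]" by (rule degree_eq_zeroE)
  then show ?thesis by simp
next
  case False
  obtain c u where cu: "p = pCons c u" by (rule pCons_cases)
  with False have "u \<noteq> 0" by auto
  then obtain r where r: "\<forall>z. r \<le> norm z \<longrightarrow> poly p 0 \<le> norm (poly (pCons c u) z)"
    using poly_infinity by blast
  define R where "R = max r 0"
  obtain a where a: "\<forall>y\<in>{-R..R}. poly p a \<le> poly p y"
    using continuous_attains_inf[of "{-R..R}" "poly p"]
    by (force simp: R_def intro!: continuous_intros)
  have "poly p a \<le> poly p x" for x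
  proof (cases "x \<in> {-R..R}")
    case False
    then have "r \<le> norm x" by (auto simp: R_def)
    with r cu nonneg[of x] have "poly p 0 \<le> poly p x" by auto
    moreover have "poly p a \<le> poly p 0" using a by (auto simp: R_def)
    ultimately show ?thesis by linarith
  qed (use a in auto)
  then show ?thesis by blast
qed

text \<open>
  A root of a nonnegative function is a minimum, so the derivative vanishes there too and the root is
  double. The cofactor inherits its sign away from the root, and at the root by continuity.
\<close>

lemma nonneg_poly_double_root:
  fixes p :: "real poly"
  assumes nonneg: "\<And>x. poly p x \<ge> 0" and root: "poly p a = 0"
  obtains v where "p = [:-a, 1:] ^ 2 * v" "\<And>x. poly v x \<ge> 0"
proof -
  obtain u where u: "p = [:-a, 1:] * u"
    using root poly_eq_0_iff_dvd[of p a] by (auto elim: dvdE)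
  have "poly (pderiv p) a = 0"
    using DERIV_local_min[OF poly_DERIV[of p a] zero_less_one] nonneg root by simp
  then have "poly u a = 0"
    unfolding u pderiv_mult by (simp add: pderiv_pCons)
  then obtain v where v: "u = [:-a, 1:] * v"
    using poly_eq_0_iff_dvd[of u a] by (auto elim: dvdE)
  have p: "p = [:-a, 1:] ^ 2 * v"
    unfolding u v by (simp only: power2_eq_square mult.assoc)
  have off: "poly v x \<ge> 0" if "x \<noteq> a" for x
  proof -
    have "0 \<le> (x - a)\<^sup>2 * poly v x" using nonneg[of x] by (simp add: p algebra_simps)
    moreover have "(x - a)\<^sup>2 > 0" using that by simp
    ultimately show ?thesis by (simp add: zero_le_mult_iff)
  qed
  have "poly v a \<ge> 0"
  proof (rule tendsto_lowerbound)
    show "(poly v \<longlongrightarrow> poly v a) (at a)"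
      using poly_isCont isCont_def by blast
    show "\<forall>\<^sub>F x in at a. 0 \<le> poly v x"
      using off by (auto simp: eventually_at intro!: exI[of _ 1])
  qed simp
  with off p that show ?thesis by metis
qed

text \<open>
  Subtracting the minimum value \<open>\<mu>\<close>, attained at \<open>a\<close>, leaves a nonnegative polynomial with a root,
  which is \<open>(x - a)\<^sup>2\<close> times a nonnegative polynomial of smaller degree. A representation of that
  factor, multiplied through by \<open>x - a\<close>, together with the constant \<open>sqrt \<mu>\<close> represents the
  polynomial.
\<close>

lemma nonneg_poly_sum_of_squares:
  fixes p :: "real poly"
  assumes "\<And>x. poly p x \<ge> 0"
  shows "\<exists>(m::nat) q. (\<forall>r<m. 2 * degree (q r) \<le> degree p) \<and> p = (\<Sum>r<m. q r ^ 2)"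
  using assms
proof (induction "degree p" arbitrary: p rule: less_induct)
  case less
  obtain a where a: "\<And>x. poly p a \<le> poly p x"
    using nonneg_poly_attains_min less.prems by blast
  define \<mu> where "\<mu> = poly p a"
  have \<mu>: "\<mu> \<ge> 0" using less.prems by (simp add: \<mu>_def)
  show ?case
  proof (cases "degree p = 0")
    case True
    then obtain c where c: "p = [:c:]" by (rule degree_eq_zeroE)
    with less.prems[of 0] have "p = [:sqrt c:] ^ 2" by (simp add: power2_eq_square)
    then show ?thesis
      by (intro exI[of _ 1] exI[of _ "\<lambda>_. [:sqrt c:]"]) simp
  next
    case False
    obtain v where v: "p - [:\<mu>:] = [:-a, 1:] ^ 2 * v" "\<And>x. poly v x \<ge> 0"
      using nonneg_poly_double_root[of "p - [:\<mu>:]" a] a by (auto simp: \<mu>_def)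
    have "v \<noteq> 0" using v(1) False by auto
    have "degree p = degree (p - [:\<mu>:] + [:\<mu>:])" by simp
    also have "\<dots> = degree (p - [:\<mu>:])"
    proof (rule degree_add_eq_left)
      show "degree [:\<mu>:] < degree (p - [:\<mu>:])"
      proof (rule ccontr)
        assume "\<not> ?thesis"
        then have "degree (p - [:\<mu>:]) = 0" by simp
        then have "degree (p - [:\<mu>:] + [:\<mu>:]) \<le> 0" by (intro degree_add_le) auto
        with False show False by simp
      qed
    qed
    also have "\<dots> = 2 + degree v"
      unfolding v(1) using \<open>v \<noteq> 0\<close> by (simp add: degree_mult_eq degree_power_eq)
    finally have deg: "degree p = 2 + degree v" .
    then obtain m :: nat and q where q: "\<forall>r<m. 2 * degree (q r) \<le> degree v" "v = (\<Sum>r<m. q r ^ 2)"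
      using less.hyps[of v] v(2) by auto
    define q' where "q' r = (if r < m then [:-a, 1:] * q r else [:sqrt \<mu>:])" for r
    have "2 * degree (q' r) \<le> degree p" for r
    proof (cases "r < m")
      case True
      have "degree (q' r) \<le> 1 + degree (q r)"
        using degree_mult_le[of "[:-a, 1:]" "q r"] True by (simp add: q'_def)
      then show ?thesis using q(1) True deg by fastforce
    qed (simp add: q'_def)
    moreover have "p = (\<Sum>r<Suc m. q' r ^ 2)"
    proof -
      have "(\<Sum>r<m. q' r ^ 2) = (\<Sum>r<m. [:-a, 1:] ^ 2 * q r ^ 2)"
        by (intro sum.cong) (simp_all only: q'_def power_mult_distrib if_True lessThan_iff)
      also have "\<dots> = p - [:\<mu>:]" unfolding v(1) q(2) by (simp add: sum_distrib_left)
      finally show ?thesis using \<mu> by (simp add: q'_def power2_eq_square)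
    qed
    ultimately show ?thesis by blast
  qed
qed


section \<open>Evaluation is a ring homomorphism\<close>

definition meval :: "(nat \<Rightarrow>\<^sub>0 nat) \<Rightarrow> (nat \<Rightarrow> real) \<Rightarrow> real" where
  "meval m x = (\<Prod>i\<in>Poly_Mapping.keys m. x i ^ Poly_Mapping.lookup m i)"

lemma meval_superset:
  assumes "finite A" "Poly_Mapping.keys m \<subseteq> A"
  shows "meval m x = (\<Prod>i\<in>A. x i ^ Poly_Mapping.lookup m i)"
  unfolding meval_def using assms by (intro prod.mono_neutral_left) (auto simp: in_keys_iff)

lemma meval_add: "meval (a + b) x = meval a x * meval b x"
proof -
  let ?A = "Poly_Mapping.keys a \<union> Poly_Mapping.keys b"
  have "meval (a + b) x = (\<Prod>i\<in>?A. x i ^ Poly_Mapping.lookup (a + b) i)"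
    using Poly_Mapping.keys_add[of a b] by (intro meval_superset) auto
  then show ?thesis
    using meval_superset[of ?A a x] meval_superset[of ?A b x]
    by (simp add: lookup_add power_add prod.distrib)
qed

lemma meval_cong:
  "(\<And>i. i \<in> Poly_Mapping.keys m \<Longrightarrow> x i = y i) \<Longrightarrow> meval m x = meval m y"
  unfolding meval_def by (intro prod.cong) auto

lemma meval_indicator: "meval m (indicator T) = of_bool (Poly_Mapping.keys m \<subseteq> T)"
  by (auto simp: meval_def indicator_def in_keys_iff zero_power intro!: prod.neutral prod_zero)

lemma peval_superset:
  assumes "finite A" "Poly_Mapping.keys p \<subseteq> A"
  shows "peval p x = (\<Sum>m\<in>A. Poly_Mapping.lookup p m * meval m x)"
  unfolding peval_def meval_def
  using assms by (intro sum.mono_neutral_left) (auto simp: in_keys_iff)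

lemma peval_add: "peval (p + q) x = peval p x + peval q x"
proof -
  let ?A = "Poly_Mapping.keys p \<union> Poly_Mapping.keys q"
  have "peval (p + q) x = (\<Sum>m\<in>?A. Poly_Mapping.lookup (p + q) m * meval m x)"
    using Poly_Mapping.keys_add[of p q] by (intro peval_superset) auto
  then show ?thesis
    using peval_superset[of ?A p x] peval_superset[of ?A q x]
    by (simp add: lookup_add distrib_right sum.distrib)
qed

lemma peval_single: "peval (Poly_Mapping.single m c) x = c * meval m x"
  using peval_superset[of "{m}" "Poly_Mapping.single m c" x] by simp

lemma peval_0: "peval 0 x = 0"
  by (simp add: peval_def)

lemma peval_uminus: "peval (- p) x = - peval p x"
  using peval_add[of p "- p" x] by (simp add: peval_0)

lemma peval_diff: "peval (p - q) x = peval p x - peval q x"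
  using peval_add[of p "- q" x] by (simp add: peval_uminus)

lemma peval_sum: "peval (\<Sum>a\<in>A. f a) x = (\<Sum>a\<in>A. peval (f a) x)"
  by (induction A rule: infinite_finite_induct) (simp_all add: peval_0 peval_add)

lemma rpoly_sum_monomials:
  fixes p :: rpoly
  shows "p = (\<Sum>m\<in>Poly_Mapping.keys p. Poly_Mapping.single m (Poly_Mapping.lookup p m))"
proof (rule poly_mapping_eqI)
  fix m
  show "Poly_Mapping.lookup p m = Poly_Mapping.lookup
      (\<Sum>m\<in>Poly_Mapping.keys p. Poly_Mapping.single m (Poly_Mapping.lookup p m)) m"
    by (simp add: lookup_sum lookup_single when_def in_keys_iff)
qed

lemma peval_mult: "peval (p * q) x = peval p x * peval q x"
proof -
  let ?P = "Poly_Mapping.keys p" and ?Q = "Poly_Mapping.keys q"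
  have "p * q = (\<Sum>a\<in>?P. \<Sum>b\<in>?Q.
      Poly_Mapping.single (a + b) (Poly_Mapping.lookup p a * Poly_Mapping.lookup q b))"
    by (subst rpoly_sum_monomials[of p], subst rpoly_sum_monomials[of q])
       (simp add: sum_product mult_single)
  then have "peval (p * q) x = (\<Sum>a\<in>?P. \<Sum>b\<in>?Q.
      (Poly_Mapping.lookup p a * meval a x) * (Poly_Mapping.lookup q b * meval b x))"
    by (simp add: peval_sum peval_single meval_add algebra_simps)
  then show ?thesis
    using peval_superset[of ?P p x] peval_superset[of ?Q q x] by (simp add: sum_product)
qed

lemma peval_one: "peval 1 x = 1"
  using peval_single[of 0 1 x] by (simp add: meval_def)

lemma peval_power: "peval (p ^ k) x = peval p x ^ k"
  by (induction k) (simp_all add: peval_one peval_mult)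

lemma peval_pvar: "peval (pvar k) x = x k"
  unfolding pvar_def peval_single by (simp add: meval_def)

lemma peval_cong:
  assumes "\<And>i. i \<in> pvars p \<Longrightarrow> x i = y i"
  shows "peval p x = peval p y"
proof -
  have "meval m x = meval m y" if "m \<in> Poly_Mapping.keys p" for m
    using that assms by (intro meval_cong) (auto simp: pvars_def)
  then show ?thesis
    by (simp add: peval_superset[OF finite_keys order_refl])
qed


section \<open>Mixed second derivatives of a multilinear polynomial are second differences\<close>

lemma keys_sum_single_subset:
  "Poly_Mapping.keys (\<Sum>a\<in>A. Poly_Mapping.single (h a) (c a)) \<subseteq> h ` {a \<in> A. c a \<noteq> 0}"
proof
  fix m assume "m \<in> Poly_Mapping.keys (\<Sum>a\<in>A. Poly_Mapping.single (h a) (c a))"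
  then have "(\<Sum>a\<in>A. c a when h a = m) \<noteq> 0"
    by (simp add: in_keys_iff lookup_sum lookup_single)
  then obtain a where "a \<in> A" "(c a when h a = m) \<noteq> 0"
    by (rule sum.not_neutral_contains_not_neutral)
  then show "m \<in> h ` {a \<in> A. c a \<noteq> 0}" by (auto simp: when_def split: if_splits)
qed

lemma keys_pderivative:
  "Poly_Mapping.keys (pderivative i p) \<subseteq>
    (\<lambda>m. m - Poly_Mapping.single i 1) ` {m \<in> Poly_Mapping.keys p. Poly_Mapping.lookup m i \<noteq> 0}"
  unfolding pderivative_def by (rule order_trans[OF keys_sum_single_subset]) auto

lemma multilinear_pderivative:
  assumes "multilinear p"
  shows "multilinear (pderivative i p)"
  unfolding multilinear_def
proof (intro ballI allI)
  fix m k assume "m \<in> Poly_Mapping.keys (pderivative i p)"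
  then obtain m' where "m' \<in> Poly_Mapping.keys p" "m = m' - Poly_Mapping.single i 1"
    using keys_pderivative by blast
  then show "Poly_Mapping.lookup m k \<le> 1"
    using assms by (auto simp: multilinear_def lookup_minus intro: diff_le_self[THEN le_trans])
qed

lemma pvars_pderivative:
  assumes "multilinear p"
  shows "pvars (pderivative i p) \<subseteq> pvars p - {i}"
proof
  fix k assume "k \<in> pvars (pderivative i p)"
  then obtain m where m: "m \<in> Poly_Mapping.keys p"
    "k \<in> Poly_Mapping.keys (m - Poly_Mapping.single i 1)"
    using keys_pderivative[of i p] by (auto simp: pvars_def)
  then have "Poly_Mapping.lookup m k \<noteq> 0" "k \<noteq> i"
    using assms by (auto simp: multilinear_def in_keys_iff lookup_minus lookup_single when_def)
  with m show "k \<in> pvars p - {i}" by (auto simp: pvars_def in_keys_iff)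
qed

text \<open>
  In one variable a multilinear polynomial is affine, and the slope of an affine function is its
  increment from \<open>0\<close> to \<open>1\<close>.
\<close>

lemma meval_difference:
  assumes "Poly_Mapping.lookup m i \<le> 1"
  shows "meval m (x(i := 1)) - meval m (x(i := 0)) =
    real (Poly_Mapping.lookup m i) * meval (m - Poly_Mapping.single i 1) x"
proof (cases "Poly_Mapping.lookup m i = 0")
  case True
  then have "meval m (x(i := c)) = meval m x" for c
    by (intro meval_cong) (auto simp: in_keys_iff)
  with True show ?thesis by simp
next
  case False
  with assms have one: "Poly_Mapping.lookup m i = 1" by simp
  let ?e = "Poly_Mapping.single i (1::nat)"
  have m: "m = ?e + (m - ?e)"
    using one by (intro poly_mapping_eqI) (auto simp: lookup_add lookup_minus lookup_single when_def)
  have "meval (m - ?e) (x(i := c)) = meval (m - ?e) x" for c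
    using one by (intro meval_cong) (auto simp: in_keys_iff lookup_minus)
  moreover have "meval ?e y = y i" for y by (simp add: meval_def)
  ultimately have "meval m (x(i := c)) = c * meval (m - ?e) x" for c
    by (subst m) (simp add: meval_add)
  with one show ?thesis by simp
qed

lemma peval_pderivative:
  assumes "multilinear p"
  shows "peval (pderivative i p) x = peval p (x(i := 1)) - peval p (x(i := 0))"
proof -
  have "peval (pderivative i p) x = (\<Sum>m\<in>Poly_Mapping.keys p. Poly_Mapping.lookup p m *
      (real (Poly_Mapping.lookup m i) * meval (m - Poly_Mapping.single i 1) x))"
    by (simp add: pderivative_def peval_sum peval_single algebra_simps)
  also have "\<dots> = (\<Sum>m\<in>Poly_Mapping.keys p. Poly_Mapping.lookup p m *
      (meval m (x(i := 1)) - meval m (x(i := 0))))"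
    using assms by (intro sum.cong refl) (simp add: meval_difference multilinear_def)
  also have "\<dots> = peval p (x(i := 1)) - peval p (x(i := 0))"
    by (simp add: peval_superset[OF finite_keys order_refl] algebra_simps sum_subtractf)
  finally show ?thesis .
qed

lemma peval_pderivative_indicator:
  assumes "multilinear p" "i \<notin> S"
  shows "peval (pderivative i p) (indicator S) =
    peval p (indicator (insert i S)) - peval p (indicator S)"
proof -
  have "(indicator S)(i := 1) = (indicator (insert i S) :: nat \<Rightarrow> real)"
    "(indicator S)(i := 0) = (indicator S :: nat \<Rightarrow> real)"
    using assms(2) by (auto simp: indicator_def fun_eq_iff)
  then show ?thesis using assms(1) by (simp add: peval_pderivative)
qed

lemma peval_mixed_pderivative_indicator:
  assumes "multilinear p" "i \<notin> S" "j \<notin> S" "i \<noteq> j"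
  shows "peval (pderivative i (pderivative j p)) (indicator S) =
    peval p (indicator (insert i (insert j S))) - peval p (indicator (insert i S))
      - peval p (indicator (insert j S)) + peval p (indicator S)"
  using assms
  by (simp add: peval_pderivative_indicator multilinear_pderivative insert_commute)


section \<open>Polynomials vanishing on the cube lie in the Boolean ideal\<close>

lemma poly_ring_carrier: "p \<in> carrier (poly_ring V) \<longleftrightarrow> pvars p \<subseteq> V"
  by (simp add: poly_ring_def)

lemma carrier_add:
  "p \<in> carrier (poly_ring V) \<Longrightarrow> q \<in> carrier (poly_ring V) \<Longrightarrow> p + q \<in> carrier (poly_ring V)"
  using pvars_add[of p q] by (auto simp: poly_ring_carrier)

lemma carrier_mult:
  "p \<in> carrier (poly_ring V) \<Longrightarrow> q \<in> carrier (poly_ring V) \<Longrightarrow> p * q \<in> carrier (poly_ring V)"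
  using pvars_mult[of p q] by (auto simp: poly_ring_carrier)

lemma carrier_uminus: "p \<in> carrier (poly_ring V) \<Longrightarrow> - p \<in> carrier (poly_ring V)"
  by (simp add: poly_ring_carrier pvars_uminus)

lemma carrier_diff:
  "p \<in> carrier (poly_ring V) \<Longrightarrow> q \<in> carrier (poly_ring V) \<Longrightarrow> p - q \<in> carrier (poly_ring V)"
  using carrier_add[of p V "- q"] carrier_uminus by simp

lemma carrier_single: "Poly_Mapping.keys m \<subseteq> V \<Longrightarrow> Poly_Mapping.single m c \<in> carrier (poly_ring V)"
  by (auto simp: poly_ring_carrier pvars_def)

lemma carrier_pvar: "k \<in> V \<Longrightarrow> pvar k \<in> carrier (poly_ring V)"
  unfolding pvar_def by (rule carrier_single) simp

lemma carrier_power: "p \<in> carrier (poly_ring V) \<Longrightarrow> p ^ k \<in> carrier (poly_ring V)"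
proof (induction k)
  case 0
  then show ?case by (simp add: poly_ring_carrier pvars_def)
qed (simp add: carrier_mult)

lemma carrier_sum:
  "(\<And>a. a \<in> A \<Longrightarrow> f a \<in> carrier (poly_ring V)) \<Longrightarrow> (\<Sum>a\<in>A. f a) \<in> carrier (poly_ring V)"
proof (induction A rule: infinite_finite_induct)
  case (insert a A)
  then show ?case by (simp add: carrier_add)
qed (simp_all add: poly_ring_carrier pvars_def)

lemma boolean_ideal_zero: "0 \<in> boolean_ideal V"
  using additive_subgroup.zero_closed[OF ideal.axioms(1)[OF boolean_ideal_ideal[of V]]]
  by (simp add: poly_ring_def)

lemma boolean_ideal_add:
  "p \<in> boolean_ideal V \<Longrightarrow> q \<in> boolean_ideal V \<Longrightarrow> p + q \<in> boolean_ideal V"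
  using additive_subgroup.a_closed[OF ideal.axioms(1)[OF boolean_ideal_ideal[of V]]]
  by (simp add: poly_ring_def)

lemma boolean_ideal_mult:
  "p \<in> carrier (poly_ring V) \<Longrightarrow> q \<in> boolean_ideal V \<Longrightarrow> p * q \<in> boolean_ideal V"
  using ideal.I_l_closed[OF boolean_ideal_ideal[of V]] by (simp add: poly_ring_def)

lemma boolean_ideal_sum:
  "(\<And>a. a \<in> A \<Longrightarrow> f a \<in> boolean_ideal V) \<Longrightarrow> (\<Sum>a\<in>A. f a) \<in> boolean_ideal V"
  by (induction A rule: infinite_finite_induct) (simp_all add: boolean_ideal_zero boolean_ideal_add)

lemma boolean_ideal_generator:
  assumes "k \<in> V"
  shows "pvar k ^ 2 - pvar k \<in> boolean_ideal V"
proof -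
  interpret R: cring "poly_ring V" by (rule poly_ring_cring)
  have "(\<lambda>k. pvar k ^ 2 - pvar k) ` V \<subseteq> carrier (poly_ring V)"
    by (auto intro!: carrier_diff carrier_power carrier_pvar)
  then show ?thesis
    unfolding boolean_ideal_def using R.genideal_self assms by blast
qed

lemma mdegree_superset:
  "finite A \<Longrightarrow> Poly_Mapping.keys m \<subseteq> A \<Longrightarrow> mdegree m = (\<Sum>i\<in>A. Poly_Mapping.lookup m i)"
  unfolding mdegree_def by (intro sum.mono_neutral_left) (auto simp: in_keys_iff)

lemma mdegree_add: "mdegree (a + b) = mdegree a + mdegree b"
proof -
  let ?A = "Poly_Mapping.keys a \<union> Poly_Mapping.keys b"
  have "mdegree (a + b) = (\<Sum>i\<in>?A. Poly_Mapping.lookup (a + b) i)"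
    using Poly_Mapping.keys_add[of a b] by (intro mdegree_superset) auto
  then show ?thesis
    using mdegree_superset[of ?A a] mdegree_superset[of ?A b] by (simp add: lookup_add sum.distrib)
qed

text \<open>
  Subtracting a multiple of \<open>x\<^sub>k\<^sup>2 - x\<^sub>k\<close> lowers an exponent that is at least two by one. The exponent
  stays positive, so the support is kept, and the degree drops until every exponent is at most one.
\<close>

lemma single_cong_squarefree:
  assumes "Poly_Mapping.keys m \<subseteq> V"
  shows "Poly_Mapping.single m 1 - Poly_Mapping.single (set_monom (Poly_Mapping.keys m)) 1
    \<in> boolean_ideal V"
  using assms
proof (induction "mdegree m" arbitrary: m rule: less_induct)
  case less
  show ?case
  proof (cases "\<forall>i. Poly_Mapping.lookup m i \<le> 1")
    case True
    then show ?thesis by (simp add: set_monom_keys boolean_ideal_zero)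
  next
    case False
    then obtain k where k: "Poly_Mapping.lookup m k \<ge> 2"
      by (metis not_less_eq_eq Suc_1 One_nat_def)
    let ?e = "Poly_Mapping.single k (1::nat)"
    define a where "a = m - ?e - ?e"
    have m: "m = a + ?e + ?e"
      using k by (intro poly_mapping_eqI)
        (auto simp: a_def lookup_add lookup_minus lookup_single when_def)
    have keys: "Poly_Mapping.keys (a + ?e) = Poly_Mapping.keys m"
      by (subst m) (auto simp: in_keys_iff lookup_add lookup_single when_def)
    have keys_a: "Poly_Mapping.keys a \<subseteq> V"
      using less.prems by (subst (asm) m) (auto simp: in_keys_iff lookup_add)
    have kV: "k \<in> V" using k less.prems by (auto simp: in_keys_iff)
    have "mdegree (a + ?e) < mdegree m"
      by (subst m) (simp add: mdegree_add, simp add: mdegree_def)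
    then have IH: "Poly_Mapping.single (a + ?e) 1 -
        Poly_Mapping.single (set_monom (Poly_Mapping.keys m)) 1 \<in> boolean_ideal V"
      using less.hyps[of "a + ?e"] less.prems keys by simp
    have "Poly_Mapping.single a 1 * (pvar k ^ 2 - pvar k) =
        Poly_Mapping.single m 1 - Poly_Mapping.single (a + ?e) 1"
      by (subst m) (simp add: pvar_def power2_eq_square right_diff_distrib mult_single add.assoc)
    moreover have "Poly_Mapping.single a 1 * (pvar k ^ 2 - pvar k) \<in> boolean_ideal V"
      by (intro boolean_ideal_mult carrier_single boolean_ideal_generator keys_a kV)
    ultimately have "Poly_Mapping.single m 1 - Poly_Mapping.single (a + ?e) 1 \<in> boolean_ideal V"
      by simp
    from boolean_ideal_add[OF this IH] show ?thesis by simp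
  qed
qed

definition multilinear_reduct :: "rpoly \<Rightarrow> rpoly" where
  "multilinear_reduct p = (\<Sum>m\<in>Poly_Mapping.keys p.
     Poly_Mapping.single (set_monom (Poly_Mapping.keys m)) (Poly_Mapping.lookup p m))"

lemma multilinear_multilinear_reduct: "multilinear (multilinear_reduct p)"
  unfolding multilinear_def
proof (intro ballI allI)
  fix m i assume "m \<in> Poly_Mapping.keys (multilinear_reduct p)"
  then obtain m' :: "nat \<Rightarrow>\<^sub>0 nat" where "m = set_monom (Poly_Mapping.keys m')"
    unfolding multilinear_reduct_def using keys_sum_single_subset by fast
  then show "Poly_Mapping.lookup m i \<le> 1" by (simp add: lookup_set_monom)
qed

lemma multilinear_reduct_cong:
  assumes "p \<in> carrier (poly_ring V)"
  shows "p - multilinear_reduct p \<in> boolean_ideal V"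
proof -
  let ?s = "\<lambda>m. set_monom (Poly_Mapping.keys m)" and ?c = "Poly_Mapping.lookup p"
  have "p - multilinear_reduct p = (\<Sum>m\<in>Poly_Mapping.keys p.
      Poly_Mapping.single m (?c m) - Poly_Mapping.single (?s m) (?c m))"
    by (subst (1) rpoly_sum_monomials) (simp add: multilinear_reduct_def sum_subtractf)
  also have "\<dots> = (\<Sum>m\<in>Poly_Mapping.keys p. Poly_Mapping.single 0 (?c m) *
      (Poly_Mapping.single m 1 - Poly_Mapping.single (?s m) 1))"
    by (simp add: right_diff_distrib mult_single)
  also have "\<dots> \<in> boolean_ideal V"
    using assms
    by (intro boolean_ideal_sum boolean_ideal_mult carrier_single single_cong_squarefree)
       (auto simp: poly_ring_carrier pvars_def)
  finally show ?thesis .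
qed

lemma peval_multilinear_reduct:
  "peval (multilinear_reduct p) (indicator T) = peval p (indicator T)"
  unfolding multilinear_reduct_def peval_sum peval_single meval_indicator
  by (simp add: keys_set_monom peval_superset[OF finite_keys order_refl] meval_indicator)

text \<open>
  The value at \<open>1\<^sub>T\<close> is the sum of the coefficients of the monomials supported in \<open>T\<close>; once those of the
  proper subsets are known to vanish, only the coefficient of \<open>T\<close> itself is left.
\<close>

lemma multilinear_vanishing_eq_0:
  assumes "multilinear p" and van: "\<And>T. finite T \<Longrightarrow> peval p (indicator T) = 0"
  shows "p = 0"
proof (rule poly_mapping_eqI)
  have coeff: "Poly_Mapping.lookup p (set_monom T) = 0" if "finite T" for T
    using that
  proof (induction T rule: finite_psubset_induct)
    case (psubset T)
    have "(\<Sum>S\<in>Pow T. Poly_Mapping.lookup p (set_monom S)) = 0"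
      using van peval_indicator[OF assms(1)] psubset.hyps by simp
    moreover have "(\<Sum>S\<in>Pow T - {T}. Poly_Mapping.lookup p (set_monom S)) = 0"
      using psubset.IH by (intro sum.neutral) auto
    ultimately show ?case
      using psubset.hyps sum.remove[of "Pow T" T "\<lambda>S. Poly_Mapping.lookup p (set_monom S)"] by simp
  qed
  fix m
  show "Poly_Mapping.lookup p m = Poly_Mapping.lookup 0 m"
  proof (cases "m \<in> Poly_Mapping.keys p")
    case True
    then show ?thesis
      using assms(1) coeff[of "Poly_Mapping.keys m"] by (simp add: multilinear_def set_monom_keys)
  qed (simp add: in_keys_iff)
qed

text \<open>
  Modulo the ideal a polynomial equals its multilinear reduct, which has the same values on the cube;
  and a multilinear polynomial is determined by those values.
\<close>

lemma vanishing_on_cube_in_boolean_ideal: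
  assumes "p \<in> carrier (poly_ring V)"
    and van: "\<And>S. S \<subseteq> V \<Longrightarrow> finite S \<Longrightarrow> peval p (indicator S) = 0"
  shows "p \<in> boolean_ideal V"
proof -
  have "multilinear_reduct p = 0"
  proof (rule multilinear_vanishing_eq_0[OF multilinear_multilinear_reduct])
    fix T :: "nat set" assume "finite T"
    have "peval p (indicator T) = peval p (indicator (T \<inter> V))"
      using assms(1) by (intro peval_cong) (auto simp: poly_ring_carrier indicator_def)
    with van[of "T \<inter> V"] \<open>finite T\<close> show "peval (multilinear_reduct p) (indicator T) = 0"
      by (simp add: peval_multilinear_reduct)
  qed
  with multilinear_reduct_cong[OF assms(1)] show ?thesis by simp
qed


section \<open>Univariate polynomials in the sum of the variables\<close>

lemma total_degree_le_iff:
  "total_degree p \<le> t \<longleftrightarrow> (\<forall>m\<in>Poly_Mapping.keys p. mdegree m \<le> t)"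
  by (auto simp: total_degree_def)

lemma total_degree_sum_le:
  assumes "\<And>a. a \<in> A \<Longrightarrow> total_degree (f a) \<le> t"
  shows "total_degree (\<Sum>a\<in>A. f a) \<le> t"
  using assms
proof (induction A rule: infinite_finite_induct)
  case (insert a A)
  then have "\<forall>m\<in>Poly_Mapping.keys (f a) \<union> Poly_Mapping.keys (sum f A). mdegree m \<le> t"
    by (auto simp: total_degree_le_iff)
  with insert.hyps show ?case
    using Poly_Mapping.keys_add[of "f a" "sum f A"] by (auto simp: total_degree_le_iff)
qed (simp_all add: total_degree_le_iff)

lemma total_degree_mult_le: "total_degree (p * q) \<le> total_degree p + total_degree q"
  unfolding total_degree_le_iff
proof
  fix m assume "m \<in> Poly_Mapping.keys (p * q)"
  then obtain a b where "m = a + b" "a \<in> Poly_Mapping.keys p" "b \<in> Poly_Mapping.keys q"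
    using Poly_Mapping.keys_mult[of p q] by auto
  then show "mdegree m \<le> total_degree p + total_degree q"
    using total_degree_le_iff[of p "total_degree p"] total_degree_le_iff[of q "total_degree q"]
    by (auto simp: mdegree_add intro: add_mono)
qed

lemma total_degree_single_le: "total_degree (Poly_Mapping.single m c) \<le> mdegree m"
  by (simp add: total_degree_le_iff)

lemma total_degree_power_le: "total_degree (p ^ k) \<le> k * total_degree p"
proof (induction k)
  case 0
  have "total_degree 1 \<le> 0" unfolding total_degree_le_iff by (simp add: mdegree_def)
  then show ?case by simp
next
  case (Suc k)
  then show ?case using total_degree_mult_le[of p "p ^ k"] by simp
qed

text \<open>
  The composition of \<open>q\<close> with the sum of the variables, whose value at \<open>1\<^sub>S\<close> is the cardinality of \<open>S\<close>.
\<close>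

definition sum_lift :: "nat set \<Rightarrow> real poly \<Rightarrow> rpoly" where
  "sum_lift V q =
     (\<Sum>i\<le>degree q. Poly_Mapping.single 0 (coeff q i) * (\<Sum>k\<in>V. pvar k) ^ i)"

lemma sum_lift_carrier: "sum_lift V q \<in> carrier (poly_ring V)"
  unfolding sum_lift_def
  by (intro carrier_sum carrier_mult carrier_power carrier_pvar carrier_single) auto

lemma total_degree_sum_lift: "total_degree (sum_lift V q) \<le> degree q"
  unfolding sum_lift_def
proof (rule total_degree_sum_le)
  fix i assume "i \<in> {..degree q}"
  have "total_degree (pvar k) \<le> 1" for k
    using total_degree_single_le[of "Poly_Mapping.single k 1" 1] by (simp add: pvar_def mdegree_def)
  then have s: "total_degree (\<Sum>k\<in>V. pvar k) \<le> 1" by (rule total_degree_sum_le)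
  have "total_degree (Poly_Mapping.single 0 (coeff q i) * (\<Sum>k\<in>V. pvar k) ^ i)
      \<le> total_degree (Poly_Mapping.single 0 (coeff q i)) + i * total_degree (\<Sum>k\<in>V. pvar k)"
    by (rule order_trans[OF total_degree_mult_le add_left_mono[OF total_degree_power_le]])
  also have "\<dots> \<le> 0 + i * 1"
    using s total_degree_single_le[of 0 "coeff q i"]
    by (intro add_mono mult_left_mono) (simp_all add: mdegree_def)
  finally show "total_degree (Poly_Mapping.single 0 (coeff q i) * (\<Sum>k\<in>V. pvar k) ^ i) \<le> degree q"
    using \<open>i \<in> {..degree q}\<close> by simp
qed

lemma peval_sum_lift:
  assumes "finite V" "S \<subseteq> V"
  shows "peval (sum_lift V q) (indicator S) = poly q (real (card S))"
proof -
  have "(\<Sum>k\<in>V. indicator S k :: real) = real (card S)"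
    using assms by (simp add: indicator_def sum.If_cases Int_absorb1)
  then show ?thesis
    by (simp add: sum_lift_def peval_sum peval_mult peval_power peval_single peval_pvar
        meval_def poly_altdef)
qed


section \<open>Concave functions of the cardinality\<close>

text \<open>
  The negated second difference is, at each real point, twice the excess of \<open>\<phi>\<close> at a midpoint over the
  mean of its values at the two ends, hence nonnegative.
\<close>

lemma concave_poly_second_difference_sum_of_squares:
  fixes \<phi> :: "real poly"
  assumes "concave_on UNIV (poly \<phi>)" "degree \<phi> \<le> 2 * d"
  obtains m :: nat and q :: "nat \<Rightarrow> real poly" where "\<And>r. r < m \<Longrightarrow> degree (q r) \<le> d"
    "\<And>x. 2 * poly \<phi> (x + 1) - poly \<phi> x - poly \<phi> (x + 2) = (\<Sum>r<m. poly (q r) x ^ 2)"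
proof -
  define g where "g = smult 2 (pcompose \<phi> [:1, 1:]) - \<phi> - pcompose \<phi> [:2, 1:]"
  have g: "poly g x = 2 * poly \<phi> (x + 1) - poly \<phi> x - poly \<phi> (x + 2)" for x
    by (simp add: g_def poly_pcompose add.commute)
  have "poly g x \<ge> 0" for x
  proof -
    have "convex_on UNIV (\<lambda>x. - poly \<phi> x)"
      using assms(1) by (simp add: concave_on_def)
    from convex_onD[OF this, of "1/2" x "x + 2"]
    have "- poly \<phi> ((1/2) * x + (1/2) * (x + 2)) \<le> - (1/2) * poly \<phi> x - (1/2) * poly \<phi> (x + 2)"
      by simp
    moreover have "(1/2) * x + (1/2) * (x + 2) = x + 1" by (simp add: field_simps)
    ultimately show ?thesis by (simp add: g)
  qed
  then obtain m :: nat and q where q: "\<forall>r<m. 2 * degree (q r) \<le> degree g" "g = (\<Sum>r<m. q r ^ 2)"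
    using nonneg_poly_sum_of_squares[of g] by blast
  have "degree g \<le> 2 * d"
    unfolding g_def using assms(2)
    by (intro degree_diff_le) (auto simp: degree_pcompose)
  with q(1) have "degree (q r) \<le> d" if "r < m" for r using that by fastforce
  moreover have "poly g x = (\<Sum>r<m. poly (q r) x ^ 2)" for x
    by (subst q(2)) (simp add: poly_sum)
  ultimately show ?thesis using that g by metis
qed

theorem proposition13:
  fixes n d :: nat and \<phi> :: "real poly"
  assumes "n \<ge> 1"
    and "concave_on UNIV (poly \<phi>)"
    and "degree \<phi> = 2 * d"
    and "d \<le> n - 1"
  shows "sos_submodular n d (\<lambda>S. poly \<phi> (real (card S)))"
proof -
  obtain m :: nat and q :: "nat \<Rightarrow> real poly" where q: "\<And>r. r < m \<Longrightarrow> degree (q r) \<le> d"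
    and sos: "\<And>x. 2 * poly \<phi> (x + 1) - poly \<phi> x - poly \<phi> (x + 2) = (\<Sum>r<m. poly (q r) x ^ 2)"
    using concave_poly_second_difference_sum_of_squares[of \<phi> d] assms(2,3) by auto
  define F where "F = mle n (\<lambda>S. poly \<phi> (real (card S)))"
  have F: "pvars F \<subseteq> {1..n}" "multilinear F"
    and F_cube: "\<And>S. S \<subseteq> {1..n} \<Longrightarrow> peval F (indicator S) = poly \<phi> (real (card S))"
    using is_mle_mle[of n "\<lambda>S. poly \<phi> (real (card S))"]
    unfolding F_def[symmetric] by (auto simp: is_mle_def poly_ring_carrier)
  show ?thesis
    unfolding sos_submodular_def F_def[symmetric]
  proof (intro ballI impI)
    fix i j assume ij: "i \<in> {1..n}" "j \<in> {1..n}" "i \<noteq> j"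
    define V where "V = {1..n} - {i, j}"
    let ?D = "- pderivative i (pderivative j F)"
    have "pvars (pderivative i (pderivative j F)) \<subseteq> V"
      using pvars_pderivative[OF F(2), of j]
        pvars_pderivative[OF multilinear_pderivative[OF F(2), of j], of i] F(1)
      by (auto simp: V_def)
    then have D: "?D \<in> carrier (poly_ring V)"
      by (simp add: poly_ring_carrier pvars_uminus)
    have "?D - (\<Sum>r<m. sum_lift V (q r) ^ 2) \<in> boolean_ideal V"
    proof (rule vanishing_on_cube_in_boolean_ideal)
      show "?D - (\<Sum>r<m. sum_lift V (q r) ^ 2) \<in> carrier (poly_ring V)"
        by (intro carrier_diff D carrier_sum carrier_power sum_lift_carrier)
      fix S assume S: "S \<subseteq> V" "finite S"
      then have notin: "i \<notin> S" "j \<notin> S" and sub: "S \<subseteq> {1..n}" by (auto simp: V_def)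
      have "peval ?D (indicator S) = 2 * poly \<phi> (real (card S) + 1) - poly \<phi> (real (card S))
          - poly \<phi> (real (card S) + 2)"
        using ij notin sub S(2)
        by (simp add: peval_uminus peval_mixed_pderivative_indicator[OF F(2) notin ij(3)]
            F_cube algebra_simps)
      then show "peval (?D - (\<Sum>r<m. sum_lift V (q r) ^ 2)) (indicator S) = 0"
        using S(1) by (simp add: sos peval_diff peval_sum peval_power peval_sum_lift V_def)
    qed
    moreover have "total_degree (sum_lift V (q r)) \<le> d" if "r < m" for r
      using total_degree_sum_lift q[OF that] by (rule order_trans)
    ultimately show "sos_modulo ({1..n} - {i, j}) d (boolean_ideal ({1..n} - {i, j})) ?D"
      unfolding V_def[symmetric] sos_modulo_def
      by (intro exI[of _ m] exI[of _ "\<lambda>r. sum_lift V (q r)"]) (simp add: sum_lift_carrier)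
  qed
qed

end
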